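(* Let $N$ be a proper element of an $L$-module $M$. (1) $N$ is classical prime if and only if $(N:K)\in L$ is prime for every $K\in M$ with $K\not\leqslant N$. (2) If $N$ is classical prime, then $(N:I_M)\in L$ is prime. (3) If $N$ is classical prime, then $(N:K)=(N:rK)$ for all proper elements $r\in L$ and $K\in M$ such that $rK\not\leqslant N$. (4) If $N$ is classical prime and $M$ is a multiplication lattice $L$-module, then $\{(N:K)\mid K\in M,\ K\not\leqslant N\}$ is a chain of prime elements of $L$.
   Context: A multiplicative lattice $L$ is a complete lattice (least element $0$, greatest element $1$) with a commutative, associative multiplication that distributes over arbitrary joins and has $1$ as identity. An element $a$ of a complete lattice is compact if $a\leqslant \bigvee X$ implies $a\leqslant x_1\vee\cdots\vee x_n$ for finitely many $x_i\in X$. Standing assumption: every element of $L$ is a join of compact elements of $L$, $1$ is compact, and finite products of compact elements of $L$ are compact. An element $a\in L$ is proper if $a<1$; a proper $p\in L$ is prime if for all $a,b\in L$, $ab\leqslant p$ implies $a\leqslant p$ or $b\leqslant p$. An $L$-module $M$ is a complete lattice (least element $O_M$, greatest element $I_M$) with a multiplication $L\times M\to M$, $(a,A)\mapsto aA$, such that $(\bigvee_\alpha a_\alpha)A=\bigvee_\alpha a_\alpha A$, $a(\bigvee_\alpha A_\alpha)=\bigvee_\alpha aA_\alpha$, $(ab)A=a(bA)$, $1A=A$, $0A=O_M$. For $A,B\in M$, $(A:B)=\bigvee\{x\in L\mid xB\leqslant A\}\in L$. $M$ is a multiplication lattice $L$-module if every $N\in M$ has the form $N=aI_M$ with $a\in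 L$. $N\in M$ is proper if $N<I_M$. A proper $N\in M$ is classical prime if for all $K\in M$, $a,b\in L$, $abK\leqslant N$ implies $aK\leqslant N$ or $bK\leqslant N$. *)

theory Defs
  imports Main
begin

definition (in complete_lattice) compact_element :: "'a \<Rightarrow> bool" where
  "compact_element a \<longleftrightarrow>
     (\<forall>X. a \<le> Sup X \<longrightarrow> (\<exists>F. finite F \<and> F \<subseteq> X \<and> a \<le> Sup F))"

text \<open>The least element of a multiplicative lattice is \<open>bot\<close>; its greatest element is
  required to be the unit \<open>1\<close> of the multiplication.\<close>

class multiplicative_lattice = complete_lattice + comm_monoid_mult +
  assumes one_eq_top: "1 = top"
    and mult_Sup_distrib: "a * Sup X = (SUP x\<in>X. a * x)"

text \<open>Together with compactness of \<open>1\<close>, closure under binary products gives closure of the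
  compact elements under all finite products.\<close>

class compactly_generated_multiplicative_lattice = multiplicative_lattice +
  assumes join_of_compact: "\<exists>X. (\<forall>x\<in>X. compact_element x) \<and> a = Sup X"
    and compact_one: "compact_element 1"
    and compact_mult: "compact_element a \<Longrightarrow> compact_element b \<Longrightarrow> compact_element (a * b)"

definition prime_element :: "'l::multiplicative_lattice \<Rightarrow> bool" where
  "prime_element p \<longleftrightarrow> p < 1 \<and> (\<forall>a b. a * b \<le> p \<longrightarrow> a \<le> p \<or> b \<le> p)"

locale lattice_module =
  fixes act :: "'l::multiplicative_lattice \<Rightarrow> 'm::complete_lattice \<Rightarrow> 'm" (infixr "\<cdot>" 75)
  assumes Sup_act: "Sup X \<cdot> A = (SUP x\<in>X. x \<cdot> A)"
    and act_Sup: "a \<cdot> Sup Y = (SUP A\<in>Y. a \<cdot> A)"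
    and mult_act: "(a * b) \<cdot> A = a \<cdot> (b \<cdot> A)"
    and one_act: "1 \<cdot> A = A"
    and bot_act: "bot \<cdot> A = bot"

text \<open>\<open>residual act A B\<close> is the element \<open>(A : B)\<close> of the multiplicative lattice.\<close>

definition residual ::
    "('l::multiplicative_lattice \<Rightarrow> 'm::complete_lattice \<Rightarrow> 'm) \<Rightarrow> 'm \<Rightarrow> 'm \<Rightarrow> 'l" where
  "residual act A B = Sup {x. act x B \<le> A}"

definition multiplication_lattice_module ::
    "('l::multiplicative_lattice \<Rightarrow> 'm::complete_lattice \<Rightarrow> 'm) \<Rightarrow> bool" where
  "multiplication_lattice_module act \<longleftrightarrow> lattice_module act \<and> (\<forall>N. \<exists>a. N = act a top)"

definition classical_prime ::
    "('l::multiplicative_lattice \<Rightarrow> 'm::complete_lattice \<Rightarrow> 'm) \<Rightarrow> 'm \<Rightarrow> bool" where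
  "classical_prime act N \<longleftrightarrow>
     N < top \<and> (\<forall>K a b. act (a * b) K \<le> N \<longrightarrow> act a K \<le> N \<or> act b K \<le> N)"

end

theory Submission
  imports Defs
begin

text \<open>
  Residuation, \<open>x \<le> (N : K)\<close> iff \<open>xK \<le> N\<close>, translates statements about products in the module
  into statements about \<open>(N : K)\<close>. In a multiplication module every \<open>K\<close> is of the form \<open>r I\<close>, with
  \<open>I\<close> the greatest element, so that \<open>(N : K) = (N : I)\<close> whenever \<open>K\<close> is not below a classical
  prime \<open>N\<close>: the chain in (4) has only one element.
\<close>

context lattice_module
begin

text \<open>If \<open>x \<le> y\<close>, then \<open>y\<close> is the join of \<open>{x, y}\<close>,
  and the action distributes over this join.\<close>

lemma act_mono_left:
  assumes "x \<le> y"
  shows "x \<cdot> A \<le> y \<cdot> A"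
proof -
  have "y \<cdot> A = Sup {x, y} \<cdot> A"
    using assms by (simp add: sup_absorb2)
  also have "\<dots> = sup (x \<cdot> A) (y \<cdot> A)"
    by (simp only: Sup_act) simp
  finally show ?thesis
    by (metis sup_ge1)
qed

lemma act_le: "a \<cdot> A \<le> A"
  by (metis act_mono_left one_act one_eq_top top_greatest)

text \<open>The action distributes over joins in its first argument, so the supremum defining the
  residual is itself a member of the set it is taken over.\<close>

lemma le_residual_iff: "x \<le> residual act N K \<longleftrightarrow> x \<cdot> K \<le> N"
proof
  assume "x \<le> residual act N K"
  then have "x \<cdot> K \<le> residual act N K \<cdot> K"
    by (rule act_mono_left)
  also have "\<dots> \<le> N"
    unfolding residual_def Sup_act by (auto intro: SUP_least)
  finally show "x \<cdot> K \<le> N" .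
qed (simp add: residual_def Sup_upper)

lemma residual_less_one_iff: "residual act N K < 1 \<longleftrightarrow> \<not> K \<le> N"
  by (metis le_residual_iff less_top one_act one_eq_top top_unique)

lemma prime_residual_iff:
  "prime_element (residual act N K) \<longleftrightarrow>
    \<not> K \<le> N \<and> (\<forall>a b. (a * b) \<cdot> K \<le> N \<longrightarrow> a \<cdot> K \<le> N \<or> b \<cdot> K \<le> N)"
  unfolding prime_element_def by (simp add: le_residual_iff residual_less_one_iff)

text \<open>The elements \<open>K \<le> N\<close>, on which primeness of the residual says nothing,
  satisfy the classical prime condition trivially, since \<open>a \<cdot> K \<le> K\<close>.\<close>

lemma classical_prime_iff_prime_residual:
  assumes "N < top"
  shows "classical_prime act N \<longleftrightarrow> (\<forall>K. \<not> K \<le> N \<longrightarrow> prime_element (residual act N K))"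
  using assms act_le order_trans unfolding classical_prime_def prime_residual_iff by blast

lemma classical_prime_residual_act:
  assumes "classical_prime act N" and "\<not> r \<cdot> K \<le> N"
  shows "residual act N (r \<cdot> K) = residual act N K"
proof (rule order.antisym)
  have "x \<le> residual act N (r \<cdot> K) \<longleftrightarrow> x \<le> residual act N K" for x
  proof -
    \<comment> \<open>Apply the classical prime condition to the product \<open>x * r\<close>; the
      alternative \<open>r \<cdot> K \<le> N\<close> is excluded.\<close>
    have "x \<cdot> r \<cdot> K \<le> N \<Longrightarrow> x \<cdot> K \<le> N"
      using assms unfolding classical_prime_def by (metis mult_act)
    \<comment> \<open>By commutativity the left side is
      \<open>r \<cdot> (x \<cdot> K)\<close>.\<close>
    moreover have "x \<cdot> r \<cdot> K \<le> x \<cdot> K"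
      by (metis act_le mult.commute mult_act)
    ultimately show ?thesis
      by (auto simp: le_residual_iff intro: order_trans)
  qed
  then show "residual act N (r \<cdot> K) \<le> residual act N K"
    and "residual act N K \<le> residual act N (r \<cdot> K)"
    by blast+
qed

end

lemma multiplication_module_residual_eq:
  assumes "multiplication_lattice_module act" and "classical_prime act N" and "\<not> K \<le> N"
  shows "residual act N K = residual act N top"
proof -
  interpret lattice_module act
    using assms(1) by (simp add: multiplication_lattice_module_def)
  obtain r where "K = act r top"
    using assms(1) by (auto simp: multiplication_lattice_module_def)
  then show ?thesis
    using classical_prime_residual_act assms(2,3) by simp
qed

theorem theorem3p6:
  fixes act :: "'l::compactly_generated_multiplicative_lattice \<Rightarrow> 'm::complete_lattice \<Rightarrow> 'm"
    and N :: 'm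
  assumes "lattice_module act"
    and "N < top"
  shows "(classical_prime act N \<longleftrightarrow> (\<forall>K. \<not> K \<le> N \<longrightarrow> prime_element (residual act N K))) \<and>
    (classical_prime act N \<longrightarrow> prime_element (residual act N top)) \<and>
    (classical_prime act N \<longrightarrow>
       (\<forall>r K. r < 1 \<longrightarrow> \<not> act r K \<le> N \<longrightarrow> residual act N K = residual act N (act r K))) \<and>
    (classical_prime act N \<and> multiplication_lattice_module act \<longrightarrow>
       (\<forall>p \<in> {residual act N K | K. \<not> K \<le> N}. prime_element p) \<and>
       Complete_Partial_Order.chain (\<le>) {residual act N K | K. \<not> K \<le> N})"
proof -
  interpret lattice_module act
    by fact
  have prime: "prime_element (residual act N K)" if "classical_prime act N" "\<not> K \<le> N" for K
    using that assms(2) classical_prime_iff_prime_residual by blast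
  \<comment> \<open>As \<open>N\<close> is proper, \<open>top\<close> is an admissible
    \<open>K\<close>, which yields (2).\<close>
  have "\<not> top \<le> N"
    using assms(2) by (simp add: less_le_not_le)
  show ?thesis
  proof (intro conjI impI)
    show "classical_prime act N \<longleftrightarrow> (\<forall>K. \<not> K \<le> N \<longrightarrow> prime_element (residual act N K))"
      using assms(2) by (rule classical_prime_iff_prime_residual)
  next
    assume "classical_prime act N"
    then show "prime_element (residual act N top)"
      using \<open>\<not> top \<le> N\<close> by (rule prime)
  next
    assume "classical_prime act N"
    then show "\<forall>r K. r < 1 \<longrightarrow> \<not> act r K \<le> N \<longrightarrow>
        residual act N K = residual act N (act r K)"
      using classical_prime_residual_act by metis
  next
    assume "classical_prime act N \<and> multiplication_lattice_module act"
    then show "\<forall>p \<in> {residual act N K | K. \<not> K \<le> N}. prime_element p"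
      using prime by blast
  next
    assume "classical_prime act N \<and> multiplication_lattice_module act"
    \<comment> \<open>Any two members are thus equal, so reflexivity makes them comparable.\<close>
    then have "p = residual act N top" if "p \<in> {residual act N K | K. \<not> K \<le> N}" for p
      using that multiplication_module_residual_eq by blast
    then show "Complete_Partial_Order.chain (\<le>) {residual act N K | K. \<not> K \<le> N}"
      by (metis (no_types, lifting) chainI order_refl)
  qed
qed

end
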